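(* Let $p$ be a prime and $K$ a finite extension of $\mathbb{Q}_p$ with maximal ideal $\mathfrak{p}$ of $\mathcal{O}_K$. For each positive integer $n$, there are infinitely many $x_0 \in K$ such that $D_{K,\mathfrak{p}}(x_0)$ has exactly $n$ anti-partial derivatives in $K$.
   Context: $\nu_{\mathfrak{p}}$ is the unique discrete valuation on $K$ extending $\nu_p$. $D_{K,\mathfrak{p}}(x) = x\,\nu_{\mathfrak{p}}(x)/p$ for $x\neq 0$, $D_{K,\mathfrak{p}}(0)=0$. An anti-partial derivative of $y\in K$ is an element $x\in K$ with $D_{K,\mathfrak{p}}(x)=y$. *)

theory Defs
  imports Complex_Main "HOL-Computational_Algebra.Primes"
    "HOL-Algebra.QuotRing" "HOL-Algebra.Embedded_Algebras"
begin

text \<open>The field of p-adic numbers is the completion of the rationals with respect to the p-adic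
  absolute value: p-adic Cauchy sequences of rationals modulo p-adic null sequences.\<close>

definition rat_padic_val :: "nat \<Rightarrow> rat \<Rightarrow> int" where
  "rat_padic_val p r =
     int (multiplicity (int p) (fst (quotient_of r))) - int (multiplicity (int p) (snd (quotient_of r)))"

definition rat_padic_abs :: "nat \<Rightarrow> rat \<Rightarrow> real" where
  "rat_padic_abs p r = (if r = 0 then 0 else real p powi (- rat_padic_val p r))"

definition padic_Cauchy :: "nat \<Rightarrow> (nat \<Rightarrow> rat) \<Rightarrow> bool" where
  "padic_Cauchy p X \<longleftrightarrow>
     (\<forall>\<epsilon>>0. \<exists>N. \<forall>m\<ge>N. \<forall>n\<ge>N. rat_padic_abs p (X m - X n) < \<epsilon>)"

definition padic_null :: "nat \<Rightarrow> (nat \<Rightarrow> rat) \<Rightarrow> bool" where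
  "padic_null p X \<longleftrightarrow> (\<lambda>n. rat_padic_abs p (X n)) \<longlonglongrightarrow> 0"

definition padic_Cauchy_ring :: "nat \<Rightarrow> (nat \<Rightarrow> rat) ring" where
  "padic_Cauchy_ring p =
     \<lparr>carrier = {X. padic_Cauchy p X},
      mult = (\<lambda>X Y n. X n * Y n), one = (\<lambda>_. 1),
      zero = (\<lambda>_. 0), add = (\<lambda>X Y n. X n + Y n)\<rparr>"

definition Qp :: "nat \<Rightarrow> (nat \<Rightarrow> rat) set ring" where
  "Qp p = padic_Cauchy_ring p Quot {X. padic_null p X}"

definition Qp_of_rat :: "nat \<Rightarrow> rat \<Rightarrow> (nat \<Rightarrow> rat) set" where
  "Qp_of_rat p r = {X. padic_null p X} +>\<^bsub>padic_Cauchy_ring p\<^esub> (\<lambda>_. r)"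

text \<open>Along a Cauchy sequence that is not a null sequence the valuation of the terms is eventually
  constant, and the eventual value depends only on the class.  Valuations are only meaningful on
  nonzero elements; the value \<open>\<infinity>\<close> at zero is not represented.\<close>

definition Qp_val :: "nat \<Rightarrow> (nat \<Rightarrow> rat) set \<Rightarrow> int" where
  "Qp_val p a = (THE k. \<forall>X\<in>a. eventually (\<lambda>n. rat_padic_val p (X n) = k) sequentially)"

definition finite_extension_of_Qp ::
  "nat \<Rightarrow> ('a, 'b) ring_scheme \<Rightarrow> ((nat \<Rightarrow> rat) set \<Rightarrow> 'a) \<Rightarrow> bool" where
  "finite_extension_of_Qp p K \<iota> \<longleftrightarrow>
     field K \<and> \<iota> \<in> ring_hom (Qp p) K \<and>
     ring.finite_dimension K (\<iota> ` carrier (Qp p)) (carrier K)"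

text \<open>Values are rational rather than integral: the valuation is normalised by extending the p-adic
  one, so its value group is generated by the inverse of the ramification index.\<close>

definition discrete_valuation :: "('a, 'b) ring_scheme \<Rightarrow> ('a \<Rightarrow> rat) \<Rightarrow> bool" where
  "discrete_valuation K \<nu> \<longleftrightarrow>
     (\<forall>x \<in> carrier K - {\<zero>\<^bsub>K\<^esub>}. \<forall>y \<in> carrier K - {\<zero>\<^bsub>K\<^esub>}. \<nu> (x \<otimes>\<^bsub>K\<^esub> y) = \<nu> x + \<nu> y) \<and>
     (\<forall>x \<in> carrier K - {\<zero>\<^bsub>K\<^esub>}. \<forall>y \<in> carrier K - {\<zero>\<^bsub>K\<^esub>}.
        x \<oplus>\<^bsub>K\<^esub> y \<noteq> \<zero>\<^bsub>K\<^esub> \<longrightarrow> min (\<nu> x) (\<nu> y) \<le> \<nu> (x \<oplus>\<^bsub>K\<^esub> y)) \<and>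
     (\<exists>c>0. \<nu> ` (carrier K - {\<zero>\<^bsub>K\<^esub>}) = range (\<lambda>k::int. of_int k * c))"

definition extends_Qp_val ::
  "nat \<Rightarrow> ('a, 'b) ring_scheme \<Rightarrow> ((nat \<Rightarrow> rat) set \<Rightarrow> 'a) \<Rightarrow> ('a \<Rightarrow> rat) \<Rightarrow> bool" where
  "extends_Qp_val p K \<iota> \<nu> \<longleftrightarrow>
     (\<forall>a \<in> carrier (Qp p) - {\<zero>\<^bsub>Qp p\<^esub>}. \<nu> (\<iota> a) = of_int (Qp_val p a))"

definition valuation_ring :: "('a, 'b) ring_scheme \<Rightarrow> ('a \<Rightarrow> rat) \<Rightarrow> ('a, 'b) ring_scheme" where
  "valuation_ring K \<nu> = K\<lparr>carrier := {x \<in> carrier K. x = \<zero>\<^bsub>K\<^esub> \<or> 0 \<le> \<nu> x}\<rparr>"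

text \<open>The rational factor \<open>\<nu> x / p\<close> is viewed in \<open>K\<close> through the embeddings of the rationals
  into \<open>Qp p\<close> and of \<open>Qp p\<close> into \<open>K\<close>.\<close>

definition partial_derivative ::
  "nat \<Rightarrow> ('a, 'b) ring_scheme \<Rightarrow> ((nat \<Rightarrow> rat) set \<Rightarrow> 'a) \<Rightarrow> ('a \<Rightarrow> rat) \<Rightarrow> 'a \<Rightarrow> 'a" where
  "partial_derivative p K \<iota> \<nu> x =
     (if x = \<zero>\<^bsub>K\<^esub> then \<zero>\<^bsub>K\<^esub> else x \<otimes>\<^bsub>K\<^esub> \<iota> (Qp_of_rat p (\<nu> x / of_nat p)))"

definition anti_partial_derivatives ::
  "nat \<Rightarrow> ('a, 'b) ring_scheme \<Rightarrow> ((nat \<Rightarrow> rat) set \<Rightarrow> 'a) \<Rightarrow> ('a \<Rightarrow> rat) \<Rightarrow> 'a \<Rightarrow> 'a set" where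
  "anti_partial_derivatives p K \<iota> \<nu> y = {x \<in> carrier K. partial_derivative p K \<iota> \<nu> x = y}"

end

theory Submission
  imports Defs "HOL-Computational_Algebra.Squarefree"
begin

text \<open>If \<open>D(x) = y\<close> with \<open>y \<noteq> 0\<close> rational, then \<open>x = p y / \<nu>(x)\<close> is again rational, because \<open>\<nu>\<close> has
  rational values. So for rational \<open>x\<^sub>0\<close> only the \<open>p\<close>-adic valuation \<open>v\<close> on the rationals matters.
  An anti-partial derivative of \<open>D(x\<^sub>0)\<close> is determined by its valuation \<open>w\<close>, which ranges over the
  solutions \<open>w \<noteq> 0\<close> of \<open>w + v(w) = m\<close>, where \<open>m = v(x\<^sub>0) + v(v(x\<^sub>0))\<close>.
  Let \<open>a\<^sub>0 = 0\<close> and \<open>a\<^sub>i\<^sub>+\<^sub>1 = a\<^sub>i + p ^ a\<^sub>i\<close>. For \<open>m = a\<^sub>n\<close> the solutions are exactly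
  \<open>w = a\<^sub>n - a\<^sub>i\<close> with \<open>i < n\<close>: if \<open>p ^ k\<close> divides \<open>m - k\<close> and \<open>p ^ l\<close> divides \<open>m - l\<close> with \<open>k < l\<close>,
  then \<open>k + p ^ k \<le> l\<close>, which leaves no room between consecutive \<open>a\<^sub>i\<close>.
  Since \<open>v(a\<^sub>n) = 0\<close> for \<open>n > 0\<close>, each of the infinitely many rationals \<open>x\<^sub>0\<close> of valuation \<open>a\<^sub>n\<close> gives
  \<open>m = a\<^sub>n\<close>.\<close>

section \<open>The p-adic valuation and absolute value on the rationals\<close>

lemma rat_as_int_quotient:
  fixes r :: rat
  assumes "r \<noteq> 0"
  obtains a b where "a \<noteq> 0" "b \<noteq> 0" "r = of_int a / of_int b"
proof -
  obtain a b where quotient: "quotient_of r = (a, b)" by (cases "quotient_of r")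
  have "r = of_int a / of_int b" "b > 0"
    using quotient_of_div[OF quotient] quotient_of_denom_pos[OF quotient] .
  moreover from this have "a \<noteq> 0" using assms by auto
  ultimately show ?thesis using that[of a b] by simp
qed

lemma rat_padic_val_zero [simp]: "rat_padic_val p 0 = 0"
  by (simp add: rat_padic_val_def)

lemma rat_padic_val_minus [simp]: "rat_padic_val p (- r) = rat_padic_val p r"
  by (cases "quotient_of r") (simp add: rat_padic_val_def rat_uminus_code)

lemma rat_padic_val_of_int [simp]: "rat_padic_val p (of_int a) = int (multiplicity (int p) a)"
  by (simp add: rat_padic_val_def)

lemma rat_padic_abs_nonneg [simp]: "0 \<le> rat_padic_abs p r"
  by (simp add: rat_padic_abs_def)

lemma rat_padic_abs_zero [simp]: "rat_padic_abs p 0 = 0"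
  by (simp add: rat_padic_abs_def)

lemma rat_padic_abs_minus [simp]: "rat_padic_abs p (- r) = rat_padic_abs p r"
  by (simp add: rat_padic_abs_def)

lemma rat_padic_abs_minus_commute: "rat_padic_abs p (r - s) = rat_padic_abs p (s - r)"
  using rat_padic_abs_minus[of p "r - s"] by simp

context
  fixes p :: nat
  assumes prime_p: "prime p"
begin

lemma rat_padic_val_of_int_divide:
  assumes "a \<noteq> 0" "b \<noteq> 0"
  shows "rat_padic_val p (of_int a / of_int b)
    = int (multiplicity (int p) a) - int (multiplicity (int p) b)"
proof -
  obtain c d where quotient: "quotient_of (of_int a / of_int b) = (c, d)"
    by (cases "quotient_of (of_int a / of_int b)")
  have d_pos: "d > 0" using quotient_of_denom_pos[OF quotient] .
  have quotient_eq: "(of_int a / of_int b :: rat) = of_int c / of_int d"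
    using quotient_of_div[OF quotient] .
  hence c_nonzero: "c \<noteq> 0" using assms d_pos by auto
  have "(of_int (a * d) :: rat) = of_int (c * b)"
    using quotient_eq d_pos assms by (simp add: field_simps)
  hence "a * d = c * b" by (simp only: of_int_eq_iff)
  hence "multiplicity (int p) (a * d) = multiplicity (int p) (c * b)" by simp
  thus ?thesis
    using assms c_nonzero d_pos prime_p by (simp add: rat_padic_val_def quotient prime_elem_multiplicity_mult_distrib)
qed

lemma rat_padic_val_mult:
  assumes "r \<noteq> 0" "s \<noteq> 0"
  shows "rat_padic_val p (r * s) = rat_padic_val p r + rat_padic_val p s"
proof -
  obtain a b where r_quotient: "a \<noteq> 0" "b \<noteq> 0" "r = of_int a / of_int b"
    using rat_as_int_quotient[OF assms(1)] .
  obtain c d where s_quotient: "c \<noteq> 0" "d \<noteq> 0" "s = of_int c / of_int d"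
    using rat_as_int_quotient[OF assms(2)] .
  have "r * s = of_int (a * c) / of_int (b * d)" by (simp add: r_quotient s_quotient)
  thus ?thesis
    using r_quotient s_quotient prime_p rat_padic_val_of_int_divide[of "a * c" "b * d"]
    by (simp add: rat_padic_val_of_int_divide prime_elem_multiplicity_mult_distrib)
qed

lemma rat_padic_val_mult_of_int:
  assumes "r \<noteq> 0" "a \<noteq> 0"
  shows "rat_padic_val p (r * of_int a) = rat_padic_val p r + int (multiplicity (int p) a)"
  using rat_padic_val_mult[of r "of_int a"] assms by simp

lemma rat_padic_val_divide:
  assumes "r \<noteq> 0" "s \<noteq> 0"
  shows "rat_padic_val p (r / s) = rat_padic_val p r - rat_padic_val p s"
  using rat_padic_val_mult[of "r / s" s] assms by simp

lemma rat_padic_val_power_int: "rat_padic_val p (of_nat p powi k) = k"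
proof -
  have power: "rat_padic_val p (of_nat p ^ j) = int j" for j
    using rat_padic_val_of_int[of p "int p ^ j"] prime_gt_1_nat[OF prime_p]
    by (simp add: multiplicity_same_power')
  have "of_nat p ^ j \<noteq> (0 :: rat)" for j
    using prime_p by (simp add: prime_gt_0_nat)
  hence "rat_padic_val p (1 / of_nat p ^ j) = - int j" for j
    using rat_padic_val_divide[of 1 "of_nat p ^ j"] rat_padic_val_of_int[of p 1] power by simp
  with power show ?thesis by (simp add: power_int_def inverse_eq_divide power_one_over)
qed

lemma rat_padic_val_add:
  assumes "r \<noteq> 0" "s \<noteq> 0" "r + s \<noteq> 0"
  shows "min (rat_padic_val p r) (rat_padic_val p s) \<le> rat_padic_val p (r + s)"
proof -
  obtain a b where r_quotient: "a \<noteq> 0" "b \<noteq> 0" "r = of_int a / of_int b"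
    using rat_as_int_quotient[OF assms(1)] .
  obtain c d where s_quotient: "c \<noteq> 0" "d \<noteq> 0" "s = of_int c / of_int d"
    using rat_as_int_quotient[OF assms(2)] .
  define e i j where "e = b * d" and "i = a * d" and "j = c * b"
  have common_denom: "r = of_int i / of_int e" "s = of_int j / of_int e"
    "r + s = of_int (i + j) / of_int e"
    using r_quotient s_quotient by (simp_all add: e_def i_def j_def field_simps)
  hence nonzero: "e \<noteq> 0" "i \<noteq> 0" "j \<noteq> 0" "i + j \<noteq> 0" using assms by (auto simp del: of_int_add)
  let ?m = "multiplicity (int p)"
  have "int p ^ min (?m i) (?m j) dvd i + j"
    by (intro dvd_add multiplicity_dvd') auto
  hence "min (?m i) (?m j) \<le> ?m (i + j)"
    using nonzero prime_p by (intro multiplicity_geI) auto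
  moreover have "rat_padic_val p r = int (?m i) - int (?m e)"
    "rat_padic_val p s = int (?m j) - int (?m e)"
    unfolding common_denom(1,2) using nonzero by (simp_all add: rat_padic_val_of_int_divide)
  moreover have "rat_padic_val p (r + s) = int (?m (i + j)) - int (?m e)"
    unfolding common_denom(3) using nonzero by (intro rat_padic_val_of_int_divide)
  ultimately show ?thesis by linarith
qed

lemma rat_padic_val_add_eq:
  assumes "r \<noteq> 0" "s \<noteq> 0" "rat_padic_val p r < rat_padic_val p s"
  shows "rat_padic_val p (r + s) = rat_padic_val p r"
proof -
  have "r + s \<noteq> 0" using assms(3) by (auto simp: add_eq_0_iff)
  thus ?thesis
    using rat_padic_val_add[of r s] rat_padic_val_add[of "r + s" "- s"] assms by simp
qed

lemma infinite_rat_padic_val_eq: "infinite {r. r \<noteq> 0 \<and> rat_padic_val p r = k}"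
proof -
  define f :: "nat \<Rightarrow> rat" where "f q = of_nat p powi k * of_nat q" for q
  have p_power_nonzero: "of_nat p powi k \<noteq> (0 :: rat)" using prime_p by (simp add: prime_gt_0_nat)
  have "rat_padic_val p (of_nat q) = 0" if "prime q" "q \<noteq> p" for q
    using rat_padic_val_of_int[of p "int q"] that prime_p
    by (simp add: prime_multiplicity_other)
  hence "f ` ({q. prime q} - {p}) \<subseteq> {r. r \<noteq> 0 \<and> rat_padic_val p r = k}"
    using p_power_nonzero by (auto simp: f_def rat_padic_val_mult rat_padic_val_power_int prime_gt_0_nat)
  moreover have "inj_on f A" for A using p_power_nonzero by (auto simp: f_def inj_on_def)
  hence "infinite (f ` ({q. prime q} - {p}))" by (simp add: finite_image_iff primes_infinite)
  ultimately show ?thesis by (rule infinite_super)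
qed

lemma rat_padic_abs_pos: "r \<noteq> 0 \<Longrightarrow> 0 < rat_padic_abs p r"
  using prime_gt_0_nat[OF prime_p] by (simp add: rat_padic_abs_def)

lemma rat_padic_abs_less_iff:
  assumes "r \<noteq> 0" "s \<noteq> 0"
  shows "rat_padic_abs p s < rat_padic_abs p r \<longleftrightarrow> rat_padic_val p r < rat_padic_val p s"
proof -
  have "strict_mono (\<lambda>k. real p powi k)"
    using prime_gt_1_nat[OF prime_p] by (intro strict_monoI power_int_strict_increasing) auto
  thus ?thesis using assms by (simp add: rat_padic_abs_def strict_mono_less)
qed

lemma rat_padic_abs_mult: "rat_padic_abs p (r * s) = rat_padic_abs p r * rat_padic_abs p s"
  using prime_gt_0_nat[OF prime_p]
  by (simp add: rat_padic_abs_def rat_padic_val_mult flip: power_int_add)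

lemma rat_padic_abs_add_le_max:
  "rat_padic_abs p (r + s) \<le> max (rat_padic_abs p r) (rat_padic_abs p s)"
proof (cases "r = 0 \<or> s = 0 \<or> r + s = 0")
  case True
  thus ?thesis by (auto simp: le_max_iff_disj)
next
  case False
  thus ?thesis
    using rat_padic_val_add[of r s] rat_padic_abs_less_iff
    by (auto simp: le_max_iff_disj not_less[symmetric])
qed

lemma rat_padic_abs_add_le: "rat_padic_abs p (r + s) \<le> rat_padic_abs p r + rat_padic_abs p s"
  using rat_padic_abs_add_le_max[of r s] rat_padic_abs_nonneg[of p r] rat_padic_abs_nonneg[of p s]
  by linarith

lemma rat_padic_abs_diff_le: "rat_padic_abs p (r - s) \<le> rat_padic_abs p r + rat_padic_abs p s"
  using rat_padic_abs_add_le[of r "- s"] by simp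

end

section \<open>The p-adic numbers as a quotient ring\<close>

lemma rat_padic_abs_null_comparison:
  assumes "(g \<longlongrightarrow> 0) F" "\<And>x. rat_padic_abs p (f x) \<le> g x"
  shows "((\<lambda>x. rat_padic_abs p (f x)) \<longlongrightarrow> 0) F"
  by (rule tendsto_sandwich[OF _ _ tendsto_const assms(1)]) (simp_all add: assms(2))

lemma padic_Cauchy_iff_tendsto:
  "padic_Cauchy p X \<longleftrightarrow>
    ((\<lambda>(m, n). rat_padic_abs p (X m - X n)) \<longlongrightarrow> 0) (sequentially \<times>\<^sub>F sequentially)"
  by (auto simp: padic_Cauchy_def tendsto_iff eventually_prod_sequentially
      rat_padic_abs_minus_commute)

lemma padic_Cauchy_const: "padic_Cauchy p (\<lambda>_. r)"
  by (simp add: padic_Cauchy_def)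

lemma padic_Cauchy_minus: "padic_Cauchy p X \<Longrightarrow> padic_Cauchy p (\<lambda>n. - X n)"
  by (simp add: padic_Cauchy_def rat_padic_abs_minus_commute)

lemma padic_null_zero: "padic_null p (\<lambda>_. 0)"
  by (simp add: padic_null_def)

lemma padic_null_minus: "padic_null p X \<Longrightarrow> padic_null p (\<lambda>n. - X n)"
  by (simp add: padic_null_def)

context
  fixes p :: nat
  assumes prime_p: "prime p"
begin

lemma padic_null_add:
  assumes "padic_null p X" "padic_null p Y"
  shows "padic_null p (\<lambda>n. X n + Y n)"
proof -
  have "rat_padic_abs p (X n + Y n) \<le> rat_padic_abs p (X n) + rat_padic_abs p (Y n)" for n
    by (rule rat_padic_abs_add_le[OF prime_p])
  thus ?thesis
    using tendsto_add_zero[OF assms[unfolded padic_null_def]]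
    unfolding padic_null_def by (rule rat_padic_abs_null_comparison[rotated])
qed

lemma padic_Cauchy_add:
  assumes "padic_Cauchy p X" "padic_Cauchy p Y"
  shows "padic_Cauchy p (\<lambda>n. X n + Y n)"
proof -
  have "rat_padic_abs p (X m + Y m - (X n + Y n))
      \<le> rat_padic_abs p (X m - X n) + rat_padic_abs p (Y m - Y n)" for m n
    using rat_padic_abs_add_le[OF prime_p, of "X m - X n" "Y m - Y n"] by (simp add: algebra_simps)
  thus ?thesis
    using tendsto_add_zero[OF assms[unfolded padic_Cauchy_iff_tendsto]]
    unfolding padic_Cauchy_iff_tendsto case_prod_unfold
    by (rule rat_padic_abs_null_comparison[rotated])
qed

lemma padic_null_imp_Cauchy:
  assumes "padic_null p X"
  shows "padic_Cauchy p X"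
proof -
  have fst_snd: "filterlim fst sequentially (sequentially \<times>\<^sub>F sequentially)"
    "filterlim snd sequentially (sequentially \<times>\<^sub>F sequentially)"
    by (simp_all add: filterlim_def filtermap_fst_prod_filter filtermap_snd_prod_filter)
  have "rat_padic_abs p (X (fst z) - X (snd z))
      \<le> rat_padic_abs p (X (fst z)) + rat_padic_abs p (X (snd z))" for z
    by (rule rat_padic_abs_diff_le[OF prime_p])
  thus ?thesis
    using tendsto_add_zero[OF fst_snd[THEN filterlim_compose[OF assms[unfolded padic_null_def]]]]
    unfolding padic_Cauchy_iff_tendsto case_prod_unfold
    by (rule rat_padic_abs_null_comparison[rotated])
qed

lemma padic_Cauchy_bounded:
  assumes "padic_Cauchy p X"
  obtains B where "\<And>n. rat_padic_abs p (X n) \<le> B"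
proof -
  obtain N where X_near: "\<And>n. n \<ge> N \<Longrightarrow> rat_padic_abs p (X n - X N) < 1"
    using assms unfolding padic_Cauchy_def by (meson order_refl zero_less_one)
  have "rat_padic_abs p (X n) \<le> 1 + (\<Sum>i\<le>N. rat_padic_abs p (X i))" for n
  proof (cases "n \<le> N")
    case True
    thus ?thesis using member_le_sum[of n "{..N}" "\<lambda>i. rat_padic_abs p (X i)"] by simp
  next
    case False
    have "rat_padic_abs p (X n) \<le> rat_padic_abs p (X n - X N) + rat_padic_abs p (X N)"
      using rat_padic_abs_add_le[OF prime_p, of "X n - X N" "X N"] by simp
    thus ?thesis
      using False X_near[of n] member_le_sum[of N "{..N}" "\<lambda>i. rat_padic_abs p (X i)"] by simp
  qed
  thus ?thesis by (rule that)
qed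

lemma padic_null_Cauchy_mult:
  assumes "padic_Cauchy p X" "padic_null p Y"
  shows "padic_null p (\<lambda>n. X n * Y n)"
proof -
  obtain B where "\<And>n. rat_padic_abs p (X n) \<le> B" using padic_Cauchy_bounded[OF assms(1)] by blast
  hence "rat_padic_abs p (X n * Y n) \<le> B * rat_padic_abs p (Y n)" for n
    by (simp add: rat_padic_abs_mult[OF prime_p] mult_right_mono)
  thus ?thesis
    using tendsto_mult_right_zero[OF assms(2)[unfolded padic_null_def]]
    unfolding padic_null_def by (rule rat_padic_abs_null_comparison[rotated])
qed

lemma padic_Cauchy_mult:
  assumes "padic_Cauchy p X" "padic_Cauchy p Y"
  shows "padic_Cauchy p (\<lambda>n. X n * Y n)"
proof -
  obtain B where X_le: "\<And>n. rat_padic_abs p (X n) \<le> B" using padic_Cauchy_bounded[OF assms(1)] by blast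
  obtain C where Y_le: "\<And>n. rat_padic_abs p (Y n) \<le> C" using padic_Cauchy_bounded[OF assms(2)] by blast
  have "rat_padic_abs p (X m * Y m - X n * Y n)
      \<le> B * rat_padic_abs p (Y m - Y n) + C * rat_padic_abs p (X m - X n)" for m n
  proof -
    have "X m * Y m - X n * Y n = X m * (Y m - Y n) + Y n * (X m - X n)"
      by (simp add: algebra_simps)
    hence "rat_padic_abs p (X m * Y m - X n * Y n)
        \<le> rat_padic_abs p (X m) * rat_padic_abs p (Y m - Y n)
          + rat_padic_abs p (Y n) * rat_padic_abs p (X m - X n)"
      using rat_padic_abs_add_le[OF prime_p, of "X m * (Y m - Y n)" "Y n * (X m - X n)"]
      by (simp add: rat_padic_abs_mult[OF prime_p])
    also have "\<dots> \<le> B * rat_padic_abs p (Y m - Y n) + C * rat_padic_abs p (X m - X n)"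
      by (intro add_mono mult_right_mono X_le Y_le rat_padic_abs_nonneg)
    finally show ?thesis .
  qed
  thus ?thesis
    using tendsto_add_zero[OF tendsto_mult_right_zero[OF assms(2)[unfolded padic_Cauchy_iff_tendsto]]
        tendsto_mult_right_zero[OF assms(1)[unfolded padic_Cauchy_iff_tendsto]]]
    unfolding padic_Cauchy_iff_tendsto case_prod_unfold
    by (rule rat_padic_abs_null_comparison[rotated])
qed

lemma cring_padic_Cauchy_ring: "cring (padic_Cauchy_ring p)"
proof (intro cringI abelian_groupI comm_monoidI)
  fix X assume "X \<in> carrier (padic_Cauchy_ring p)"
  thus "\<exists>Y\<in>carrier (padic_Cauchy_ring p). Y \<oplus>\<^bsub>padic_Cauchy_ring p\<^esub> X = \<zero>\<^bsub>padic_Cauchy_ring p\<^esub>"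
    by (intro bexI[of _ "\<lambda>n. - X n"]) (simp_all add: padic_Cauchy_ring_def padic_Cauchy_minus)
qed (auto simp: padic_Cauchy_ring_def padic_Cauchy_const padic_Cauchy_add padic_Cauchy_mult
      algebra_simps)

lemma a_inv_padic_Cauchy_ring:
  assumes "padic_Cauchy p X"
  shows "\<ominus>\<^bsub>padic_Cauchy_ring p\<^esub> X = (\<lambda>n. - X n)"
proof -
  interpret cring "padic_Cauchy_ring p" by (rule cring_padic_Cauchy_ring)
  show ?thesis
    using assms padic_Cauchy_minus by (intro minus_equality) (auto simp: padic_Cauchy_ring_def)
qed

lemma ideal_padic_null: "ideal {X. padic_null p X} (padic_Cauchy_ring p)"
proof -
  interpret cring "padic_Cauchy_ring p" by (rule cring_padic_Cauchy_ring)
  show ?thesis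
  proof (rule idealI)
    show "subgroup {X. padic_null p X} (add_monoid (padic_Cauchy_ring p))"
    proof (rule add.subgroupI)
      show "{X. padic_null p X} \<subseteq> carrier (padic_Cauchy_ring p)"
        by (auto simp: padic_Cauchy_ring_def padic_null_imp_Cauchy)
      show "{X. padic_null p X} \<noteq> {}"
        using padic_null_zero by blast
    qed (auto simp: a_inv_padic_Cauchy_ring padic_null_imp_Cauchy padic_null_minus,
        simp add: padic_Cauchy_ring_def padic_null_add)
  next
    fix X Y
    assume "X \<in> {X. padic_null p X}" "Y \<in> carrier (padic_Cauchy_ring p)"
    hence "padic_null p (\<lambda>n. Y n * X n)"
      by (intro padic_null_Cauchy_mult) (auto simp: padic_Cauchy_ring_def)
    thus "Y \<otimes>\<^bsub>padic_Cauchy_ring p\<^esub> X \<in> {X. padic_null p X}"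
      "X \<otimes>\<^bsub>padic_Cauchy_ring p\<^esub> Y \<in> {X. padic_null p X}"
      by (simp_all add: padic_Cauchy_ring_def mult.commute)
  qed (rule ring_axioms)
qed

lemma ring_Qp: "ring (Qp p)"
  unfolding Qp_def by (rule ideal.quotient_is_ring[OF ideal_padic_null])

end

definition rat_ring :: "rat ring" where
  "rat_ring = \<lparr>carrier = UNIV, mult = (*), one = 1, zero = 0, add = (+)\<rparr>"

lemma field_rat_ring: "field rat_ring"
proof -
  interpret cring rat_ring
  proof (intro cringI abelian_groupI comm_monoidI)
    fix r assume "r \<in> carrier rat_ring"
    show "\<exists>s\<in>carrier rat_ring. s \<oplus>\<^bsub>rat_ring\<^esub> r = \<zero>\<^bsub>rat_ring\<^esub>"
      by (rule bexI[of _ "- r"]) (simp_all add: rat_ring_def)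
  qed (auto simp: rat_ring_def algebra_simps)
  show ?thesis
  proof (rule cring_fieldI2)
    fix r assume "r \<in> carrier rat_ring" "r \<noteq> \<zero>\<^bsub>rat_ring\<^esub>"
    thus "\<exists>s\<in>carrier rat_ring. r \<otimes>\<^bsub>rat_ring\<^esub> s = \<one>\<^bsub>rat_ring\<^esub>"
      by (intro bexI[of _ "1 / r"]) (simp_all add: rat_ring_def)
  qed (simp add: rat_ring_def)
qed

lemma Qp_of_rat_hom:
  assumes "prime p"
  shows "Qp_of_rat p \<in> ring_hom rat_ring (Qp p)"
proof -
  have "(\<lambda>r _. r) \<in> ring_hom rat_ring (padic_Cauchy_ring p)"
    by (rule ring_hom_memI) (simp_all add: rat_ring_def padic_Cauchy_ring_def padic_Cauchy_const)
  from ring_hom_trans[OF this ideal.rcos_ring_hom[OF ideal_padic_null[OF assms]]]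
  show ?thesis by (simp add: Qp_def Qp_of_rat_def[abs_def] comp_def)
qed

lemma mem_Qp_of_rat_iff:
  "X \<in> Qp_of_rat p r \<longleftrightarrow> (\<exists>Y. padic_null p Y \<and> X = (\<lambda>n. Y n + r))"
  by (auto simp: Qp_of_rat_def a_r_coset_def r_coset_def padic_Cauchy_ring_def)

lemma const_mem_Qp_of_rat: "(\<lambda>_. r) \<in> Qp_of_rat p r"
  unfolding mem_Qp_of_rat_iff using padic_null_zero by force

lemma Qp_val_of_rat:
  assumes "prime p" "r \<noteq> 0"
  shows "Qp_val p (Qp_of_rat p r) = rat_padic_val p r"
  unfolding Qp_val_def
proof (rule the_equality)
  show "\<forall>X\<in>Qp_of_rat p r. \<forall>\<^sub>F n in sequentially. rat_padic_val p (X n) = rat_padic_val p r"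
  proof
    fix X assume "X \<in> Qp_of_rat p r"
    then obtain Y where X_coset: "padic_null p Y" "X = (\<lambda>n. Y n + r)"
      unfolding mem_Qp_of_rat_iff by blast
    have "\<forall>\<^sub>F n in sequentially. rat_padic_abs p (Y n) < rat_padic_abs p r"
      using X_coset(1) rat_padic_abs_pos[OF assms] unfolding padic_null_def by (rule order_tendstoD(2))
    thus "\<forall>\<^sub>F n in sequentially. rat_padic_val p (X n) = rat_padic_val p r"
    proof eventually_elim
      case (elim n)
      show ?case
      proof (cases "Y n = 0")
        case False
        hence "rat_padic_val p (r + Y n) = rat_padic_val p r"
          using elim assms rat_padic_abs_less_iff rat_padic_val_add_eq by blast
        thus ?thesis by (simp add: X_coset(2) add.commute)
      qed (simp add: X_coset(2))
    qed
  qed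
next
  fix k assume "\<forall>X\<in>Qp_of_rat p r. \<forall>\<^sub>F n in sequentially. rat_padic_val p (X n) = k"
  from bspec[OF this const_mem_Qp_of_rat] show "k = rat_padic_val p r" by simp
qed

section \<open>The equation \<open>w + v(w) = m\<close>\<close>

fun add_power_seq :: "nat \<Rightarrow> nat \<Rightarrow> nat" where
  "add_power_seq p 0 = 0"
| "add_power_seq p (Suc n) = add_power_seq p n + p ^ add_power_seq p n"

lemma strict_mono_add_power_seq: "p > 0 \<Longrightarrow> strict_mono (add_power_seq p)"
  by (simp add: strict_mono_Suc_iff Suc_le_eq)

lemma add_power_seq_pos: "p > 0 \<Longrightarrow> n > 0 \<Longrightarrow> add_power_seq p n > 0"
  using strict_monoD[OF strict_mono_add_power_seq, of p 0 n] by simp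

lemma power_add_power_seq_dvd_diff:
  assumes "p > 0" "i \<le> j"
  shows "int p ^ add_power_seq p i dvd int (add_power_seq p j) - int (add_power_seq p i)"
  using assms(2)
proof (induction j rule: dec_induct)
  case (step j)
  have "add_power_seq p i \<le> add_power_seq p j"
    using strict_mono_add_power_seq[OF assms(1)] step(1) by (simp add: strict_mono_less_eq)
  hence "int p ^ add_power_seq p i dvd int p ^ add_power_seq p j" by (rule le_imp_power_dvd)
  from dvd_add[OF step.IH this] show ?case by (simp add: algebra_simps)
qed simp

lemma add_power_le_if_power_dvd_diff:
  fixes p k l :: nat and m :: int
  assumes "int p ^ k dvd m - int k" "int p ^ l dvd m - int l" "k < l"
  shows "k + p ^ k \<le> l"
proof -
  have "int p ^ k dvd m - int l"
    using assms(2,3) by (meson dvd_trans le_imp_power_dvd less_imp_le)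
  with assms(1) have "int p ^ k dvd (m - int k) - (m - int l)" by (rule dvd_diff)
  hence "int p ^ k \<le> int l - int k" using assms(3) by (intro zdvd_imp_le) auto
  hence "int (k + p ^ k) \<le> int l" by simp
  thus ?thesis by (simp only: of_nat_le_iff)
qed

context
  fixes p :: nat
  assumes prime_p: "prime p"
begin

lemma multiplicity_add_power_seq_diff:
  assumes "i < j"
  shows "multiplicity (int p) (int (add_power_seq p j) - int (add_power_seq p i)) = add_power_seq p i"
proof -
  let ?a = "add_power_seq p"
  have p_pos: "p > 0" using prime_p by (rule prime_gt_0_nat)
  have "?a i < ?a (Suc i)" using strict_mono_add_power_seq[OF p_pos] by (rule strict_monoD) simp
  hence "int p ^ Suc (?a i) dvd int p ^ ?a (Suc i)" by (intro le_imp_power_dvd Suc_leI)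
  also have "\<dots> dvd int (?a j) - int (?a (Suc i))"
    using power_add_power_seq_dvd_diff[OF p_pos, of "Suc i" j] assms by simp
  finally obtain t where "int (?a j) - int (?a (Suc i)) = int p ^ Suc (?a i) * t" by (elim dvdE)
  hence factored: "int (?a j) - int (?a i) = int p ^ ?a i * (1 + int p * t)"
    by (simp add: algebra_simps)
  have "\<not> int p dvd 1 + int p * t"
    using prime_p by (metis dvd_add_left_iff dvd_triv_left not_prime_unit prime_nat_int_transfer)
  thus ?thesis
    unfolding factored using p_pos by (intro multiplicity_eqI) (auto simp: mult.commute)
qed

lemma mem_add_power_seq_if_power_dvd_diff:
  assumes dvd: "int p ^ k dvd int (add_power_seq p n) - int k"
  shows "k \<in> add_power_seq p ` {..n}"
proof (rule ccontr)
  let ?a = "add_power_seq p"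
  assume "k \<notin> ?a ` {..n}"
  hence not_seq: "k \<noteq> ?a i" if "i \<le> n" for i using that by auto
  have p_pos: "p > 0" using prime_p by (rule prime_gt_0_nat)
  have "?a i < k" if "i \<le> n" for i
    using that
  proof (induction i)
    case 0
    show ?case using not_seq[of 0] by simp
  next
    case (Suc i)
    have "?a (Suc i) \<le> k"
      using add_power_le_if_power_dvd_diff[OF power_add_power_seq_dvd_diff dvd] Suc p_pos by simp
    thus ?case using not_seq[OF Suc.prems] by simp
  qed
  hence seq_less: "?a n < k" by simp
  have "int p ^ k dvd int k - int (?a n)" using dvd by (simp add: dvd_diff_commute)
  hence "int p ^ k \<le> int k - int (?a n)" using seq_less by (intro zdvd_imp_le) auto
  moreover have "int k < int p ^ k"
    unfolding of_nat_power[symmetric] of_nat_less_iff using prime_gt_1_nat[OF prime_p] by (simp add: power_gt_expt)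
  ultimately show False by simp
qed

lemma add_multiplicity_eq_add_power_seq_solutions:
  "{w. w \<noteq> 0 \<and> w + int (multiplicity (int p) w) = int (add_power_seq p n)}
    = (\<lambda>i. int (add_power_seq p n) - int (add_power_seq p i)) ` {..<n}"
  (is "?W = ?f ` _")
proof (intro equalityI subsetI)
  fix w assume "w \<in> ?W"
  moreover define k where "k = multiplicity (int p) w"
  ultimately have w: "w \<noteq> 0" "w = int (add_power_seq p n) - int k" by auto
  have "int p ^ k dvd w" unfolding k_def by (rule multiplicity_dvd)
  then obtain i where i: "i \<le> n" "k = add_power_seq p i"
    using mem_add_power_seq_if_power_dvd_diff[of k n] unfolding w(2) by auto
  with w have "i \<noteq> n" by auto
  with w(2) i show "w \<in> ?f ` {..<n}" by auto
next
  fix w assume "w \<in> ?f ` {..<n}"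
  moreover have "add_power_seq p i < add_power_seq p n" if "i < n" for i
    using that strict_mono_add_power_seq prime_gt_0_nat[OF prime_p] by (simp add: strict_mono_less)
  ultimately show "w \<in> ?W" by (force simp: multiplicity_add_power_seq_diff)
qed

end

section \<open>The partial derivative on the rationals\<close>

definition rat_partial_derivative :: "nat \<Rightarrow> rat \<Rightarrow> rat" where
  "rat_partial_derivative p r = r * of_int (rat_padic_val p r) / of_nat p"

context
  fixes p :: nat
  assumes prime_p: "prime p"
begin

lemma rat_partial_derivative_eq_0_iff:
  "rat_partial_derivative p r = 0 \<longleftrightarrow> rat_padic_val p r = 0"
  using prime_gt_0_nat[OF prime_p] by (auto simp: rat_partial_derivative_def)

lemma rat_partial_derivative_eq_iff:
  "rat_partial_derivative p r = rat_partial_derivative p s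
    \<longleftrightarrow> r * of_int (rat_padic_val p r) = s * of_int (rat_padic_val p s)"
  using prime_gt_0_nat[OF prime_p] by (simp add: rat_partial_derivative_def)

lemma bij_betw_rat_partial_derivative_fibre:
  assumes "rat_padic_val p r \<noteq> 0"
  shows "bij_betw (rat_padic_val p)
    {s. rat_partial_derivative p s = rat_partial_derivative p r}
    {w. w \<noteq> 0 \<and> w + int (multiplicity (int p) w)
      = rat_padic_val p r + int (multiplicity (int p) (rat_padic_val p r))}"
  (is "bij_betw _ ?S ?W")
proof -
  let ?v = "rat_padic_val p"
  have r_nonzero: "r \<noteq> 0" using assms by auto
  note val_mult = rat_padic_val_mult_of_int[OF prime_p]
  have fibre: "s * of_int (?v s) = r * of_int (?v r)" "s \<noteq> 0" "?v s \<noteq> 0" if "s \<in> ?S" for s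
    using that r_nonzero assms by (auto simp: rat_partial_derivative_eq_iff)
  show ?thesis
  proof (rule bij_betw_imageI)
    show "inj_on ?v ?S" using fibre by (intro inj_onI) (metis mult_right_cancel of_int_eq_0_iff)
    show "?v ` ?S = ?W"
    proof (intro equalityI subsetI)
      fix w assume "w \<in> ?v ` ?S"
      then obtain s where s: "s \<in> ?S" "w = ?v s" by blast
      have "?v (s * of_int (?v s)) = ?v (r * of_int (?v r))" using fibre(1)[OF s(1)] by simp
      thus "w \<in> ?W" using fibre(2,3)[OF s(1)] s(2) r_nonzero assms by (simp add: val_mult)
    next
      fix w assume w: "w \<in> ?W"
      define s where "s = r * of_int (?v r) / of_int w"
      have "?v s = ?v (r * of_int (?v r)) - int (multiplicity (int p) w)"
        using w r_nonzero assms unfolding s_def by (simp add: rat_padic_val_divide[OF prime_p])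
      also have "\<dots> = w" using w val_mult[OF r_nonzero assms] by simp
      finally have "?v s = w" .
      moreover have "s * of_int w = r * of_int (?v r)" using w by (simp add: s_def)
      ultimately have "s \<in> ?S" "w = ?v s" by (simp_all add: rat_partial_derivative_eq_iff)
      thus "w \<in> ?v ` ?S" by blast
    qed
  qed
qed

lemma card_rat_partial_derivative_fibre:
  assumes "n > 0" "rat_padic_val p r = int (add_power_seq p n)"
  shows "finite {s. rat_partial_derivative p s = rat_partial_derivative p r}"
    and "card {s. rat_partial_derivative p s = rat_partial_derivative p r} = n"
proof -
  let ?a = "add_power_seq p"
  have mono: "strict_mono ?a" using prime_gt_0_nat[OF prime_p] by (rule strict_mono_add_power_seq)
  have "rat_padic_val p r \<noteq> 0" using add_power_seq_pos[OF prime_gt_0_nat[OF prime_p]] assms by simp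
  moreover have "multiplicity (int p) (int (?a n)) = 0"
    using multiplicity_add_power_seq_diff[OF prime_p assms(1)] by simp
  ultimately have "bij_betw (rat_padic_val p)
      {s. rat_partial_derivative p s = rat_partial_derivative p r}
      ((\<lambda>i. int (?a n) - int (?a i)) ` {..<n})"
    using bij_betw_rat_partial_derivative_fibre[of r] assms(2)
    by (simp add: add_multiplicity_eq_add_power_seq_solutions[OF prime_p])
  moreover have "inj_on (\<lambda>i. int (?a n) - int (?a i)) {..<n}"
    using strict_mono_eq[OF mono] by (simp add: inj_on_def)
  ultimately show "finite {s. rat_partial_derivative p s = rat_partial_derivative p r}"
    and "card {s. rat_partial_derivative p s = rat_partial_derivative p r} = n"
    by (simp_all add: bij_betw_finite bij_betw_same_card card_image)
qed

end

section \<open>Anti-partial derivatives of rational elements\<close>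

locale valued_field_over_Qp = field K
  for K :: "('a, 'b) ring_scheme" (structure) +
  fixes p :: nat and \<iota> :: "(nat \<Rightarrow> rat) set \<Rightarrow> 'a" and \<nu> :: "'a \<Rightarrow> rat"
  assumes prime_p: "prime p"
    and Qp_hom: "\<iota> \<in> ring_hom (Qp p) K"
    and extends_Qp_val: "extends_Qp_val p K \<iota> \<nu>"
begin

definition rat_embedding :: "rat \<Rightarrow> 'a" where
  "rat_embedding r = \<iota> (Qp_of_rat p r)"

lemma rat_embedding_hom: "rat_embedding \<in> ring_hom rat_ring K"
  using ring_hom_trans[OF Qp_of_rat_hom[OF prime_p] Qp_hom]
  by (simp add: rat_embedding_def[abs_def] comp_def)

lemma rat_embedding_closed [simp]: "rat_embedding r \<in> carrier K"
  using ring_hom_closed[OF rat_embedding_hom] by (simp add: rat_ring_def)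

lemma rat_embedding_mult: "rat_embedding (r * s) = rat_embedding r \<otimes> rat_embedding s"
  using ring_hom_mult[OF rat_embedding_hom] by (simp add: rat_ring_def)

lemma rat_embedding_one [simp]: "rat_embedding 1 = \<one>"
  using ring_hom_one[OF rat_embedding_hom] by (simp add: rat_ring_def)

lemma rat_embedding_zero [simp]: "rat_embedding 0 = \<zero>"
  using ring_hom_zero[OF rat_embedding_hom _ ring_axioms] field_rat_ring
  by (simp add: rat_ring_def field.is_ring)

lemma inj_rat_embedding: "inj rat_embedding"
  using non_trivial_field_hom_is_inj[OF rat_embedding_hom field_rat_ring field_axioms]
  by (simp add: rat_ring_def)

lemma rat_embedding_eq_zero_iff [simp]: "rat_embedding r = \<zero> \<longleftrightarrow> r = 0"
  using inj_eq[OF inj_rat_embedding, of r 0] by simp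

lemma val_rat_embedding:
  assumes "r \<noteq> 0"
  shows "\<nu> (rat_embedding r) = of_int (rat_padic_val p r)"
proof -
  have "Qp_of_rat p r \<in> carrier (Qp p)"
    using ring_hom_closed[OF Qp_of_rat_hom[OF prime_p]] by (simp add: rat_ring_def)
  moreover have "Qp_of_rat p r \<noteq> \<zero>\<^bsub>Qp p\<^esub>"
    using ring_hom_zero[OF Qp_hom ring_Qp[OF prime_p] ring_axioms] rat_embedding_eq_zero_iff[of r] assms
    by (auto simp: rat_embedding_def)
  ultimately show ?thesis
    using extends_Qp_val Qp_val_of_rat[OF prime_p assms]
    by (simp add: extends_Qp_val_def rat_embedding_def)
qed

lemma partial_derivative_nonzero:
  "x \<noteq> \<zero> \<Longrightarrow> partial_derivative p K \<iota> \<nu> x = x \<otimes> rat_embedding (\<nu> x / of_nat p)"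
  by (simp add: partial_derivative_def rat_embedding_def)

lemma partial_derivative_rat_embedding:
  "partial_derivative p K \<iota> \<nu> (rat_embedding r) = rat_embedding (rat_partial_derivative p r)"
proof (cases "r = 0")
  case True
  thus ?thesis by (simp add: partial_derivative_def rat_partial_derivative_def)
next
  case False
  thus ?thesis
    by (simp add: partial_derivative_nonzero val_rat_embedding rat_partial_derivative_def
        flip: rat_embedding_mult)
qed

lemma anti_partial_derivative_in_range_rat_embedding:
  assumes "x \<in> carrier K" "partial_derivative p K \<iota> \<nu> x = rat_embedding r" "r \<noteq> 0"
  shows "x \<in> range rat_embedding"
proof -
  define t where "t = \<nu> x / of_nat p"
  have nonzero: "rat_embedding r \<noteq> \<zero>" using assms(3) by simp
  hence "x \<noteq> \<zero>" using assms(2) by (metis partial_derivative_def)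
  hence product: "x \<otimes> rat_embedding t = rat_embedding r"
    using assms(2) by (simp add: partial_derivative_nonzero t_def)
  hence t_nonzero: "t \<noteq> 0" using assms(1) nonzero by (metis r_null rat_embedding_zero)
  have "x = x \<otimes> (rat_embedding t \<otimes> rat_embedding (1 / t))"
    using assms(1) t_nonzero by (simp flip: rat_embedding_mult)
  also have "\<dots> = rat_embedding r \<otimes> rat_embedding (1 / t)"
    using assms(1) by (simp only: product rat_embedding_closed flip: m_assoc)
  also have "\<dots> = rat_embedding (r * (1 / t))" by (simp only: rat_embedding_mult)
  finally show ?thesis by blast
qed

lemma anti_partial_derivatives_rat_embedding:
  assumes "r \<noteq> 0"
  shows "anti_partial_derivatives p K \<iota> \<nu> (rat_embedding r)
    = rat_embedding ` {s. rat_partial_derivative p s = r}"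
  using anti_partial_derivative_in_range_rat_embedding[OF _ _ assms] inj_rat_embedding
  by (fastforce simp: anti_partial_derivatives_def partial_derivative_rat_embedding inj_eq)

end

theorem theorem2p14:
  fixes p n :: nat
    and K :: "('a, 'b) ring_scheme"
    and \<iota> :: "(nat \<Rightarrow> rat) set \<Rightarrow> 'a"
    and \<nu> :: "'a \<Rightarrow> rat"
    and P :: "'a set"
  assumes "prime p"
    and "finite_extension_of_Qp p K \<iota>"
    and "discrete_valuation K \<nu>"
    and "extends_Qp_val p K \<iota> \<nu>"
    and "maximalideal P (valuation_ring K \<nu>)"
    and "n > 0"
  shows "infinite {x\<^sub>0 \<in> carrier K.
           finite (anti_partial_derivatives p K \<iota> \<nu> (partial_derivative p K \<iota> \<nu> x\<^sub>0)) \<and>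
           card (anti_partial_derivatives p K \<iota> \<nu> (partial_derivative p K \<iota> \<nu> x\<^sub>0)) = n}"
    (is "infinite ?X")
proof -
  interpret valued_field_over_Qp K p \<iota> \<nu>
    using assms(1,2,4)
    by (simp add: valued_field_over_Qp_def valued_field_over_Qp_axioms_def finite_extension_of_Qp_def)
  let ?R = "{r. r \<noteq> 0 \<and> rat_padic_val p r = int (add_power_seq p n)}"
  have "add_power_seq p n > 0"
    using prime_gt_0_nat[OF prime_p] assms(6) by (rule add_power_seq_pos)
  hence "anti_partial_derivatives p K \<iota> \<nu> (partial_derivative p K \<iota> \<nu> (rat_embedding r))
      = rat_embedding ` {s. rat_partial_derivative p s = rat_partial_derivative p r}" if "r \<in> ?R" for r
    using that
    by (simp add: partial_derivative_rat_embedding anti_partial_derivatives_rat_embedding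
        rat_partial_derivative_eq_0_iff[OF prime_p])
  hence "rat_embedding ` ?R \<subseteq> ?X"
    using card_rat_partial_derivative_fibre[OF prime_p assms(6)]
    by (auto simp: card_image inj_on_subset[OF inj_rat_embedding])
  moreover have "infinite (rat_embedding ` ?R)"
    using infinite_rat_padic_val_eq[OF prime_p] inj_rat_embedding
    by (simp add: finite_image_iff inj_on_subset)
  ultimately show ?thesis by (rule infinite_super)
qed

end
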